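(* Let $\phi$ be a linear operator on $\mathbb{R}^n$. Then $\phi$ preserves majorization for probability distributions if and only if $\phi$ preserves vector majorization.
   Context: For $x\in\mathbb{R}^n$, $x^\downarrow$ is the vector of entries of $x$ in non-increasing order. For $a,b\in\mathbb{R}^n$, $a\preceq b$ ($a$ is majorized by $b$) means $\sum_{j=1}^k a^\downarrow_j\le\sum_{j=1}^k b^\downarrow_j$ for $k=1,\ldots,n-1$ and $\sum_{j=1}^n a^\downarrow_j=\sum_{j=1}^n b^\downarrow_j$. A vector $v\in\mathbb{R}^n$ is a probability distribution if all its entries are nonnegative and they sum to $1$. A linear operator $\phi$ on $\mathbb{R}^n$ preserves vector majorization if $a\preceq b$ implies $\phi(a)\preceq\phi(b)$ for all $a,b\in\mathbb{R}^n$; it preserves majorization for probability distributions if $a\preceq b$ implies $\phi(a)\preceq\phi(b)$ for all probability distributions $a,b\in\mathbb{R}^n$. *)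

theory Defs
  imports "HOL-Analysis.Analysis" "HOL-Library.Multiset"
begin

text \<open>
  The index type carries no order, so the non-increasing rearrangement of a vector is given as a
  list of length \<open>CARD('n)\<close>. List positions start at \<open>0\<close>: the \<open>j\<close>-th largest entry, counting from
  \<open>1\<close>, is \<open>decr_rearr x ! (j - 1)\<close>.
\<close>

definition decr_rearr :: "real ^ 'n \<Rightarrow> real list" where
  "decr_rearr x = rev (sorted_list_of_multiset (image_mset (\<lambda>i. x $ i) (mset_set UNIV)))"

lemma mset_decr_rearr: "mset (decr_rearr x) = image_mset (\<lambda>i. x $ i) (mset_set UNIV)"
  by (simp add: decr_rearr_def)

lemma length_decr_rearr: "length (decr_rearr (x :: real ^ 'n)) = CARD('n)"
proof -
  have "length (decr_rearr x) = size (mset (decr_rearr x))"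
    by simp
  then show ?thesis
    by (simp only: mset_decr_rearr size_image_mset size_mset_set)
qed

lemma sorted_decr_rearr: "sorted_wrt (\<ge>) (decr_rearr x)"
  by (simp add: decr_rearr_def sorted_wrt_rev)

definition majorized_by :: "real ^ 'n \<Rightarrow> real ^ 'n \<Rightarrow> bool" (infix "\<preceq>" 50) where
  "a \<preceq> b \<longleftrightarrow>
     (\<forall>k\<in>{1..CARD('n) - 1}. (\<Sum>j<k. decr_rearr a ! j) \<le> (\<Sum>j<k. decr_rearr b ! j)) \<and>
     (\<Sum>j<CARD('n). decr_rearr a ! j) = (\<Sum>j<CARD('n). decr_rearr b ! j)"

definition probability_distribution :: "real ^ 'n \<Rightarrow> bool" where
  "probability_distribution v \<longleftrightarrow> (\<forall>i. 0 \<le> v $ i) \<and> (\<Sum>i\<in>UNIV. v $ i) = 1"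

definition preserves_majorization :: "(real ^ 'n \<Rightarrow> real ^ 'n) \<Rightarrow> bool" where
  "preserves_majorization \<phi> \<longleftrightarrow> (\<forall>a b. a \<preceq> b \<longrightarrow> \<phi> a \<preceq> \<phi> b)"

definition preserves_majorization_prob :: "(real ^ 'n \<Rightarrow> real ^ 'n) \<Rightarrow> bool" where
  "preserves_majorization_prob \<phi> \<longleftrightarrow>
     (\<forall>a b. probability_distribution a \<and> probability_distribution b \<and> a \<preceq> b \<longrightarrow> \<phi> a \<preceq> \<phi> b)"

end

theory Submission
  imports Defs
begin

text \<open>
  Only one direction needs an argument. Let \<open>\<phi>\<close> preserve majorization for probability
  distributions, let \<open>a \<preceq> b\<close>, and let \<open>s\<close> be the image of the all-ones vector. Adding a large
  multiple \<open>t\<close> of the all-ones vector makes \<open>a\<close> and \<open>b\<close> nonnegative, and scaling then makes them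
  probability distributions; hence \<open>\<phi> a + t s \<preceq> \<phi> b + t s\<close> for all large \<open>t\<close>. If \<open>s\<close> were constant,
  the shift could be dropped at once, but in general \<open>t s\<close> moves the entries apart.

  The relation \<open>x \<preceq> y\<close> holds iff \<open>\<Sum>i. \<bar>x i - c\<bar> \<le> \<Sum>i. \<bar>y i - c\<bar>\<close> for every real \<open>c\<close>
  (\<open>majorized_by_iff_abs\<close>). Fix a value \<open>r\<close> of \<open>s\<close> and put \<open>c = t r + d\<close>. As \<open>t\<close> grows,
  the entries with \<open>s i \<noteq> r\<close> leave every bounded neighbourhood of \<open>c\<close>, so their absolute values
  become affine and contribute only a linear functional, \<open>g x = \<Sum>i. sgn (s i - r) * x i\<close>, up to a
  term common to both sides. This yields
  \<open>(\<Sum>i | s i = r. \<bar>\<phi> a i - d\<bar>) + g (\<phi> a) \<le> (\<Sum>i | s i = r. \<bar>\<phi> b i - d\<bar>) + g (\<phi> b)\<close>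
  for all \<open>d\<close> (\<open>level_set_inequality\<close>). Taking \<open>d\<close> very large and very small gives
  \<open>g (\<phi> a) \<le> g (\<phi> b)\<close>. As \<open>a \<preceq> b\<close> implies \<open>- a \<preceq> - b\<close>, the same holds for the negatives, so
  linearity forces \<open>g (\<phi> a) = g (\<phi> b)\<close>. The linear terms therefore cancel, and summing what is left
  over the finitely many values \<open>r\<close> gives \<open>\<phi> a \<preceq> \<phi> b\<close>.
\<close>

section \<open>Majorization through sums of absolute deviations\<close>

lemma sum_nth_decr_rearr:
  fixes x :: "real ^ 'n" and f :: "real \<Rightarrow> real"
  shows "(\<Sum>j<CARD('n). f (decr_rearr x ! j)) = (\<Sum>i\<in>UNIV. f (x $ i))"
proof -
  have "(\<Sum>j<CARD('n). f (decr_rearr x ! j)) = sum_list (map f (decr_rearr x))"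
    by (simp add: sum_list_sum_nth length_decr_rearr atLeast0LessThan)
  also have "\<dots> = sum_mset (image_mset f (mset (decr_rearr x)))"
    by (metis mset_map sum_mset_sum_list)
  also have "\<dots> = (\<Sum>i\<in>UNIV. f (x $ i))"
    by (simp add: mset_decr_rearr image_mset.compositionality comp_def sum_unfold_sum_mset)
  finally show ?thesis .
qed

lemma sum_nth_le_excess:
  fixes xs :: "real list"
  assumes "k \<le> length xs"
  shows "(\<Sum>j<k. xs ! j) \<le> real k * c + (\<Sum>j<length xs. max 0 (xs ! j - c))"
proof -
  have "(\<Sum>j<k. xs ! j - c) \<le> (\<Sum>j<k. max 0 (xs ! j - c))"
    by (intro sum_mono) auto
  also have "\<dots> \<le> (\<Sum>j<length xs. max 0 (xs ! j - c))"
    using assms by (intro sum_mono2) auto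
  finally show ?thesis
    by (simp add: sum_subtractf)
qed

lemma excess_eq_sum_nth:
  fixes xs :: "real list"
  assumes "k \<le> length xs"
    and above: "\<And>j. j < k \<Longrightarrow> c \<le> xs ! j"
    and below: "\<And>j. k \<le> j \<Longrightarrow> j < length xs \<Longrightarrow> xs ! j \<le> c"
  shows "(\<Sum>j<length xs. max 0 (xs ! j - c)) = (\<Sum>j<k. xs ! j) - real k * c"
proof -
  have "(\<Sum>j<length xs. max 0 (xs ! j - c)) = (\<Sum>j<k. max 0 (xs ! j - c))"
    using assms(1) below by (intro sum.mono_neutral_right) auto
  also have "\<dots> = (\<Sum>j<k. xs ! j - c)"
    using above by (intro sum.cong) auto
  finally show ?thesis
    by (simp add: sum_subtractf)
qed

text \<open>
  Partial sums and excesses are related by Legendre duality: the excess over \<open>c\<close> is the maximum over \<open>k\<close> of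
  the \<open>k\<close>-th partial sum minus \<open>k c\<close>, and that partial sum is the minimum over \<open>c\<close> of the excess
  plus \<open>k c\<close>.
\<close>

lemma prefix_sums_le_iff_excess_le:
  fixes xs ys :: "real list"
  assumes xs: "sorted_wrt (\<ge>) xs" and ys: "sorted_wrt (\<ge>) ys" and len: "length xs = length ys"
  shows "(\<forall>k\<le>length xs. (\<Sum>j<k. xs ! j) \<le> (\<Sum>j<k. ys ! j)) \<longleftrightarrow>
    (\<forall>c. (\<Sum>j<length xs. max 0 (xs ! j - c)) \<le> (\<Sum>j<length ys. max 0 (ys ! j - c)))"
    (is "?prefix \<longleftrightarrow> ?excess")
proof
  assume prefix: ?prefix
  show ?excess
  proof
    fix c
    \<comment> \<open>The maximum is attained where the decreasing list first falls to \<open>c\<close>.\<close>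
    define k where "k = length (takeWhile (\<lambda>z. c < z) xs)"
    have k: "k \<le> length xs"
      by (simp add: k_def length_takeWhile_le)
    have "(\<Sum>j<length xs. max 0 (xs ! j - c)) = (\<Sum>j<k. xs ! j) - real k * c"
    proof (rule excess_eq_sum_nth[OF k])
      fix j assume "j < k"
      then show "c \<le> xs ! j"
        unfolding k_def by (metis less_imp_le nth_mem set_takeWhileD takeWhile_nth)
    next
      fix j assume j: "k \<le> j" "j < length xs"
      then have "xs ! k \<le> c"
        using nth_length_takeWhile[of "\<lambda>z. c < z" xs] by (auto simp: k_def)
      moreover have "xs ! j \<le> xs ! k"
        using sorted_wrt_nth_less[OF xs, of k j] j by (cases "k = j") auto
      ultimately show "xs ! j \<le> c"
        by linarith
    qed
    also have "\<dots> \<le> (\<Sum>j<k. ys ! j) - real k * c"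
      using prefix k by simp
    also have "\<dots> \<le> (\<Sum>j<length ys. max 0 (ys ! j - c))"
      using sum_nth_le_excess[of k ys c] k len by simp
    finally show "(\<Sum>j<length xs. max 0 (xs ! j - c)) \<le> (\<Sum>j<length ys. max 0 (ys ! j - c))" .
  qed
next
  assume excess: ?excess
  show ?prefix
  proof (intro allI impI)
    fix k assume k: "k \<le> length xs"
    show "(\<Sum>j<k. xs ! j) \<le> (\<Sum>j<k. ys ! j)"
    proof (cases "k = 0")
      case False
      \<comment> \<open>The minimum is attained at the \<open>k\<close>-th largest entry, at position \<open>k - 1\<close>.\<close>
      define c where "c = ys ! (k - 1)"
      have mono: "ys ! j \<le> ys ! i" if "i \<le> j" "j < length ys" for i j
        using sorted_wrt_nth_less[OF ys, of i j] that by (cases "i = j") auto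
      have "(\<Sum>j<k. xs ! j) \<le> real k * c + (\<Sum>j<length xs. max 0 (xs ! j - c))"
        by (rule sum_nth_le_excess[OF k])
      also have "\<dots> \<le> real k * c + (\<Sum>j<length ys. max 0 (ys ! j - c))"
        using excess by simp
      also have "\<dots> = (\<Sum>j<k. ys ! j)"
        using excess_eq_sum_nth[of k ys c] mono k len False by (simp add: c_def)
      finally show ?thesis .
    qed simp
  qed
qed

lemma majorized_by_iff_excess:
  fixes a b :: "real ^ 'n"
  shows "a \<preceq> b \<longleftrightarrow> (\<Sum>i\<in>UNIV. a $ i) = (\<Sum>i\<in>UNIV. b $ i) \<and>
    (\<forall>c. (\<Sum>i\<in>UNIV. max 0 (a $ i - c)) \<le> (\<Sum>i\<in>UNIV. max 0 (b $ i - c)))"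
proof -
  let ?S = "\<lambda>x k. \<Sum>j<k. decr_rearr x ! j"
  \<comment> \<open>The empty prefix is harmless, and the full one is covered by the equality of the totals.\<close>
  have "a \<preceq> b \<longleftrightarrow> ?S a (CARD('n)) = ?S b (CARD('n)) \<and> (\<forall>k\<le>CARD('n). ?S a k \<le> ?S b k)"
  proof -
    have "?S a k \<le> ?S b k"
      if prefix: "\<forall>k\<in>{1..CARD('n) - 1}. ?S a k \<le> ?S b k"
        and total: "?S a (CARD('n)) = ?S b (CARD('n))" and k: "k \<le> CARD('n)"
      for k
    proof -
      consider "k = 0" | "k \<in> {1..CARD('n) - 1}" | "k = CARD('n)"
        using k by fastforce
      then show ?thesis
        using prefix total by cases auto
    qed
    then show ?thesis
      unfolding majorized_by_def by auto
  qed
  also have "\<dots> \<longleftrightarrow> (\<Sum>i\<in>UNIV. a $ i) = (\<Sum>i\<in>UNIV. b $ i) \<and>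
    (\<forall>c. (\<Sum>i\<in>UNIV. max 0 (a $ i - c)) \<le> (\<Sum>i\<in>UNIV. max 0 (b $ i - c)))"
    using prefix_sums_le_iff_excess_le[OF sorted_decr_rearr[of a] sorted_decr_rearr[of b]]
      sum_nth_decr_rearr[of "\<lambda>z. z" a] sum_nth_decr_rearr[of "\<lambda>z. z" b]
      sum_nth_decr_rearr[of "\<lambda>z. max 0 (z - c)" a for c]
      sum_nth_decr_rearr[of "\<lambda>z. max 0 (z - c)" b for c]
    by (simp add: length_decr_rearr)
  finally show ?thesis .
qed

text \<open>
  Absolute deviations encode the equality of totals as well: for \<open>c\<close> below or above all entries
  they are affine in the total, with opposite signs.
\<close>

lemma sum_abs_deviation_extreme:
  fixes x y :: "'i \<Rightarrow> real"
  assumes "finite A"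
  obtains lo hi where
    "(\<Sum>i\<in>A. \<bar>x i - lo\<bar>) = (\<Sum>i\<in>A. x i) - real (card A) * lo"
    "(\<Sum>i\<in>A. \<bar>y i - lo\<bar>) = (\<Sum>i\<in>A. y i) - real (card A) * lo"
    "(\<Sum>i\<in>A. \<bar>x i - hi\<bar>) = real (card A) * hi - (\<Sum>i\<in>A. x i)"
    "(\<Sum>i\<in>A. \<bar>y i - hi\<bar>) = real (card A) * hi - (\<Sum>i\<in>A. y i)"
proof -
  define M where "M = (\<Sum>i\<in>A. \<bar>x i\<bar> + \<bar>y i\<bar>)"
  have M: "\<bar>x i\<bar> + \<bar>y i\<bar> \<le> M" if "i \<in> A" for i
    unfolding M_def using member_le_sum[OF that, of "\<lambda>i. \<bar>x i\<bar> + \<bar>y i\<bar>"] assms by simp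
  have lo: "\<bar>x i - (- M)\<bar> = x i - (- M)" "\<bar>y i - (- M)\<bar> = y i - (- M)" if "i \<in> A" for i
    using M[OF that] by linarith+
  have hi: "\<bar>x i - M\<bar> = M - x i" "\<bar>y i - M\<bar> = M - y i" if "i \<in> A" for i
    using M[OF that] by linarith+
  show ?thesis
  proof (rule that[of "- M" M])
  qed (subst sum.cong[OF refl lo(1)] sum.cong[OF refl lo(2)]
         sum.cong[OF refl hi(1)] sum.cong[OF refl hi(2)];
       simp add: sum_subtractf sum.distrib)+
qed

lemma majorized_by_iff_abs:
  fixes a b :: "real ^ 'n"
  shows "a \<preceq> b \<longleftrightarrow> (\<forall>c. (\<Sum>i\<in>UNIV. \<bar>a $ i - c\<bar>) \<le> (\<Sum>i\<in>UNIV. \<bar>b $ i - c\<bar>))"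
proof -
  have abs_excess: "(\<Sum>i\<in>UNIV. \<bar>x $ i - c\<bar>) =
      2 * (\<Sum>i\<in>UNIV. max 0 (x $ i - c)) - (\<Sum>i\<in>UNIV. x $ i) + real CARD('n) * c"
    for x :: "real ^ 'n" and c
  proof -
    have "(\<Sum>i\<in>UNIV. \<bar>x $ i - c\<bar>) = (\<Sum>i\<in>UNIV. 2 * max 0 (x $ i - c) - x $ i + c)"
      by (intro sum.cong) (simp_all add: max_def abs_if)
    then show ?thesis
      by (simp add: sum.distrib sum_subtractf sum_distrib_left)
  qed
  have "(\<Sum>i\<in>UNIV. a $ i) = (\<Sum>i\<in>UNIV. b $ i)"
    if abs: "\<forall>c. (\<Sum>i\<in>UNIV. \<bar>a $ i - c\<bar>) \<le> (\<Sum>i\<in>UNIV. \<bar>b $ i - c\<bar>)"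
  proof -
    obtain lo hi where
      "(\<Sum>i\<in>UNIV. \<bar>a $ i - lo\<bar>) = (\<Sum>i\<in>UNIV. a $ i) - real CARD('n) * lo"
      "(\<Sum>i\<in>UNIV. \<bar>b $ i - lo\<bar>) = (\<Sum>i\<in>UNIV. b $ i) - real CARD('n) * lo"
      "(\<Sum>i\<in>UNIV. \<bar>a $ i - hi\<bar>) = real CARD('n) * hi - (\<Sum>i\<in>UNIV. a $ i)"
      "(\<Sum>i\<in>UNIV. \<bar>b $ i - hi\<bar>) = real CARD('n) * hi - (\<Sum>i\<in>UNIV. b $ i)"
      using sum_abs_deviation_extreme[of UNIV "($) a" "($) b"] by auto
    with abs[rule_format, of lo] abs[rule_format, of hi] show ?thesis
      by linarith
  qed
  then show ?thesis
    unfolding majorized_by_iff_excess by (auto simp: abs_excess)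
qed

lemma majorized_by_sum_eq: "a \<preceq> b \<Longrightarrow> (\<Sum>i\<in>UNIV. a $ i) = (\<Sum>i\<in>UNIV. b $ i)"
  by (simp add: majorized_by_iff_excess)

lemma majorized_by_uminus:
  assumes "a \<preceq> b"
  shows "- a \<preceq> - b"
proof -
  have "(\<Sum>i\<in>UNIV. \<bar>(- x) $ i - c\<bar>) = (\<Sum>i\<in>UNIV. \<bar>x $ i - (- c)\<bar>)" for x :: "real ^ 'n" and c
    by (intro sum.cong) auto
  with assms show ?thesis
    unfolding majorized_by_iff_abs by metis
qed

lemma majorized_by_add_const:
  assumes "a \<preceq> b"
  shows "a + t *\<^sub>R 1 \<preceq> b + t *\<^sub>R 1"
proof -
  have "(\<Sum>i\<in>UNIV. \<bar>(x + t *\<^sub>R 1) $ i - c\<bar>) = (\<Sum>i\<in>UNIV. \<bar>x $ i - (c - t)\<bar>)"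
    for x :: "real ^ 'n" and c
    by (intro sum.cong) (auto simp: algebra_simps)
  with assms show ?thesis
    unfolding majorized_by_iff_abs by metis
qed

lemma majorized_by_scaleR:
  assumes "a \<preceq> b" and "0 < r"
  shows "r *\<^sub>R a \<preceq> r *\<^sub>R b"
proof -
  have "(\<Sum>i\<in>UNIV. \<bar>(r *\<^sub>R x) $ i - c\<bar>) = r * (\<Sum>i\<in>UNIV. \<bar>x $ i - c / r\<bar>)" for x :: "real ^ 'n" and c
  proof -
    have "\<bar>(r *\<^sub>R x) $ i - c\<bar> = r * \<bar>x $ i - c / r\<bar>" for i
    proof -
      have "(r *\<^sub>R x) $ i - c = r * (x $ i - c / r)"
        using assms(2) by (simp add: field_simps)
      then show ?thesis
        using assms(2) by (simp add: abs_mult)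
    qed
    then show ?thesis
      by (simp add: sum_distrib_left)
  qed
  with assms show ?thesis
    unfolding majorized_by_iff_abs by (metis mult_left_mono less_imp_le)
qed

section \<open>Majorization along a ray\<close>

lemma eventually_abs_affine:
  fixes w r :: real
  shows "\<forall>\<^sub>F t in at_top. \<bar>w + t * r\<bar> = (if r = 0 then \<bar>w\<bar> else 0) + sgn r * w + t * \<bar>r\<bar>"
  using eventually_ge_at_top[of "\<bar>w\<bar> / \<bar>r\<bar>"]
proof eventually_elim
  case (elim t)
  show ?case
  proof (cases "r = 0")
    case False
    then have "\<bar>w\<bar> \<le> t * \<bar>r\<bar>"
      using elim by (simp add: field_simps)
    with False show ?thesis
      by (cases "r > 0") (simp_all add: sgn_if)
  qed simp
qed

text \<open>
  Testing with the threshold \<open>t r + d\<close> isolates the entries with \<open>s i = r\<close>: for large \<open>t\<close> every other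
  entry stays on a fixed side of the threshold, and its deviation is affine.
\<close>

lemma level_set_inequality:
  fixes u v s :: "real ^ 'n"
  assumes "\<forall>\<^sub>F t in at_top. u + t *\<^sub>R s \<preceq> v + t *\<^sub>R s"
  shows "(\<Sum>i | s $ i = r. \<bar>u $ i - d\<bar>) + (\<Sum>i\<in>UNIV. sgn (s $ i - r) * u $ i)
       \<le> (\<Sum>i | s $ i = r. \<bar>v $ i - d\<bar>) + (\<Sum>i\<in>UNIV. sgn (s $ i - r) * v $ i)"
proof -
  let ?C = "\<lambda>t. (\<Sum>i\<in>UNIV. t * \<bar>s $ i - r\<bar> - sgn (s $ i - r) * d)"
  have expand: "\<forall>\<^sub>F t in at_top. (\<Sum>i\<in>UNIV. \<bar>(x + t *\<^sub>R s) $ i - (t * r + d)\<bar>) =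
      (\<Sum>i | s $ i = r. \<bar>x $ i - d\<bar>) + (\<Sum>i\<in>UNIV. sgn (s $ i - r) * x $ i) + ?C t"
    for x :: "real ^ 'n"
  proof -
    have "\<forall>\<^sub>F t in at_top. \<forall>i. \<bar>(x $ i - d) + t * (s $ i - r)\<bar> =
        (if s $ i - r = 0 then \<bar>x $ i - d\<bar> else 0) + sgn (s $ i - r) * (x $ i - d) + t * \<bar>s $ i - r\<bar>"
      by (intro eventually_all_finite eventually_abs_affine)
    then show ?thesis
    proof eventually_elim
      case (elim t)
      have "(\<Sum>i\<in>UNIV. \<bar>(x + t *\<^sub>R s) $ i - (t * r + d)\<bar>) =
          (\<Sum>i\<in>UNIV. (if s $ i = r then \<bar>x $ i - d\<bar> else 0) + sgn (s $ i - r) * x $ i +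
            (t * \<bar>s $ i - r\<bar> - sgn (s $ i - r) * d))"
      proof (rule sum.cong)
        fix i
        have "(x + t *\<^sub>R s) $ i - (t * r + d) = (x $ i - d) + t * (s $ i - r)"
          by (simp add: algebra_simps)
        then show "\<bar>(x + t *\<^sub>R s) $ i - (t * r + d)\<bar> =
            (if s $ i = r then \<bar>x $ i - d\<bar> else 0) + sgn (s $ i - r) * x $ i +
            (t * \<bar>s $ i - r\<bar> - sgn (s $ i - r) * d)"
          using elim[rule_format, of i] by (simp add: right_diff_distrib)
      qed simp
      then show ?case
        by (simp add: sum.distrib sum.If_cases)
    qed
  qed
  have "\<forall>\<^sub>F t::real in at_top. (\<Sum>i | s $ i = r. \<bar>u $ i - d\<bar>) + (\<Sum>i\<in>UNIV. sgn (s $ i - r) * u $ i)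
       \<le> (\<Sum>i | s $ i = r. \<bar>v $ i - d\<bar>) + (\<Sum>i\<in>UNIV. sgn (s $ i - r) * v $ i)"
    using assms expand[of u] expand[of v]
  proof eventually_elim
    case (elim t)
    have "(\<Sum>i\<in>UNIV. \<bar>(u + t *\<^sub>R s) $ i - (t * r + d)\<bar>) \<le> (\<Sum>i\<in>UNIV. \<bar>(v + t *\<^sub>R s) $ i - (t * r + d)\<bar>)"
      using elim(1) unfolding majorized_by_iff_abs by blast
    then show ?case
      unfolding elim(2,3) by linarith
  qed
  then show ?thesis
    by simp
qed

lemma signed_sum_mono:
  fixes u v s :: "real ^ 'n"
  assumes "\<forall>\<^sub>F t in at_top. u + t *\<^sub>R s \<preceq> v + t *\<^sub>R s"
  shows "(\<Sum>i\<in>UNIV. sgn (s $ i - r) * u $ i) \<le> (\<Sum>i\<in>UNIV. sgn (s $ i - r) * v $ i)"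
proof -
  let ?A = "{i. s $ i = r}"
  obtain lo hi where
    "(\<Sum>i\<in>?A. \<bar>u $ i - lo\<bar>) = (\<Sum>i\<in>?A. u $ i) - real (card ?A) * lo"
    "(\<Sum>i\<in>?A. \<bar>v $ i - lo\<bar>) = (\<Sum>i\<in>?A. v $ i) - real (card ?A) * lo"
    "(\<Sum>i\<in>?A. \<bar>u $ i - hi\<bar>) = real (card ?A) * hi - (\<Sum>i\<in>?A. u $ i)"
    "(\<Sum>i\<in>?A. \<bar>v $ i - hi\<bar>) = real (card ?A) * hi - (\<Sum>i\<in>?A. v $ i)"
    using sum_abs_deviation_extreme[of ?A "($) u" "($) v"] by auto
  \<comment> \<open>At the two extremes the level set contributes its total with opposite signs, so the sum of
    the two inequalities leaves only the signed sums.\<close>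
  with level_set_inequality[OF assms, where r = r and d = lo]
    level_set_inequality[OF assms, where r = r and d = hi]
  show ?thesis
    by linarith
qed

text \<open>
  The shifted negatives make the signed sums agree, so each level set of \<open>s\<close> satisfies the deviation
  inequality by itself, and the level sets partition the indices.
\<close>

lemma majorized_by_of_rays:
  fixes u v s :: "real ^ 'n"
  assumes pos: "\<forall>\<^sub>F t in at_top. u + t *\<^sub>R s \<preceq> v + t *\<^sub>R s"
    and neg: "\<forall>\<^sub>F t in at_top. - u + t *\<^sub>R s \<preceq> - v + t *\<^sub>R s"
  shows "u \<preceq> v"
  unfolding majorized_by_iff_abs
proof
  fix d
  have level: "(\<Sum>i | s $ i = r. \<bar>u $ i - d\<bar>) \<le> (\<Sum>i | s $ i = r. \<bar>v $ i - d\<bar>)" for r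
  proof -
    have "(\<Sum>i\<in>UNIV. sgn (s $ i - r) * u $ i) = (\<Sum>i\<in>UNIV. sgn (s $ i - r) * v $ i)"
      using signed_sum_mono[OF pos, of r] signed_sum_mono[OF neg, of r]
      by (simp add: sum_negf)
    then show ?thesis
      using level_set_inequality[OF pos, where r = r and d = d] by simp
  qed
  have partition: "(\<Sum>i\<in>UNIV. \<bar>x $ i - d\<bar>) = (\<Sum>r\<in>range (($) s). \<Sum>i | s $ i = r. \<bar>x $ i - d\<bar>)"
    for x :: "real ^ 'n"
    using sum.image_gen[of UNIV "\<lambda>i. \<bar>x $ i - d\<bar>" "($) s"] by simp
  show "(\<Sum>i\<in>UNIV. \<bar>u $ i - d\<bar>) \<le> (\<Sum>i\<in>UNIV. \<bar>v $ i - d\<bar>)"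
    unfolding partition by (intro sum_mono level)
qed

section \<open>From probability distributions to arbitrary vectors\<close>

lemma preserves_majorization_prob_nonneg:
  fixes \<phi> :: "real ^ 'n \<Rightarrow> real ^ 'n"
  assumes "linear \<phi>" and "preserves_majorization_prob \<phi>"
    and "a \<preceq> b" and a: "\<And>i. 0 \<le> a $ i" and b: "\<And>i. 0 \<le> b $ i" and S: "0 < (\<Sum>i\<in>UNIV. a $ i)"
  shows "\<phi> a \<preceq> \<phi> b"
proof -
  define S where "S = (\<Sum>i\<in>UNIV. a $ i)"
  have S_pos: "0 < S" and S_b: "(\<Sum>i\<in>UNIV. b $ i) = S"
    using S majorized_by_sum_eq[OF assms(3)] by (simp_all add: S_def)
  have "probability_distribution ((1 / S) *\<^sub>R a)" "probability_distribution ((1 / S) *\<^sub>R b)"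
    unfolding probability_distribution_def using S_pos S_b a b
    by (simp_all add: sum_divide_distrib[symmetric] S_def[symmetric])
  moreover have "(1 / S) *\<^sub>R a \<preceq> (1 / S) *\<^sub>R b"
    using majorized_by_scaleR[OF assms(3)] S_pos by simp
  ultimately have "\<phi> ((1 / S) *\<^sub>R a) \<preceq> \<phi> ((1 / S) *\<^sub>R b)"
    using assms(2) unfolding preserves_majorization_prob_def by blast
  then have "S *\<^sub>R \<phi> ((1 / S) *\<^sub>R a) \<preceq> S *\<^sub>R \<phi> ((1 / S) *\<^sub>R b)"
    using S_pos by (rule majorized_by_scaleR)
  then show ?thesis
    using S_pos by (simp add: linear_scale[OF assms(1)])
qed

lemma eventually_majorized_by_shift:
  fixes \<phi> :: "real ^ 'n \<Rightarrow> real ^ 'n"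
  assumes "linear \<phi>" and "preserves_majorization_prob \<phi>" and "a \<preceq> b"
  shows "\<forall>\<^sub>F t in at_top. \<phi> a + t *\<^sub>R \<phi> 1 \<preceq> \<phi> b + t *\<^sub>R \<phi> 1"
proof -
  have "\<forall>\<^sub>F t in at_top. \<forall>i. - (a $ i) < t \<and> - (b $ i) < t"
    by (intro eventually_all_finite eventually_conj eventually_gt_at_top)
  then show ?thesis
  proof eventually_elim
    case (elim t)
    have "\<phi> (a + t *\<^sub>R 1) \<preceq> \<phi> (b + t *\<^sub>R 1)"
    proof (rule preserves_majorization_prob_nonneg[OF assms(1,2) majorized_by_add_const[OF assms(3)]])
      have entry: "0 < (a + t *\<^sub>R 1) $ i" "0 < (b + t *\<^sub>R 1) $ i" for i
        using elim[rule_format, of i] by simp_all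
      then show "0 < (\<Sum>i\<in>UNIV. (a + t *\<^sub>R 1) $ i)"
        by (intro sum_pos) simp_all
      show "0 \<le> (a + t *\<^sub>R 1) $ i" "0 \<le> (b + t *\<^sub>R 1) $ i" for i
        using entry[of i] by linarith+
    qed
    then show ?case
      by (simp add: linear_add[OF assms(1)] linear_scale[OF assms(1)])
  qed
qed

theorem theorem4p5:
  fixes \<phi> :: "real ^ 'n \<Rightarrow> real ^ 'n"
  assumes "linear \<phi>"
  shows "preserves_majorization_prob \<phi> \<longleftrightarrow> preserves_majorization \<phi>"
proof
  assume prob: "preserves_majorization_prob \<phi>"
  show "preserves_majorization \<phi>"
    unfolding preserves_majorization_def
  proof (intro allI impI)
    fix a b :: "real ^ 'n"
    assume ab: "a \<preceq> b"
    show "\<phi> a \<preceq> \<phi> b"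
    proof (rule majorized_by_of_rays)
      show "\<forall>\<^sub>F t in at_top. \<phi> a + t *\<^sub>R \<phi> 1 \<preceq> \<phi> b + t *\<^sub>R \<phi> 1"
        by (rule eventually_majorized_by_shift[OF assms prob ab])
      show "\<forall>\<^sub>F t in at_top. - \<phi> a + t *\<^sub>R \<phi> 1 \<preceq> - \<phi> b + t *\<^sub>R \<phi> 1"
        using eventually_majorized_by_shift[OF assms prob majorized_by_uminus[OF ab]]
        by (simp add: linear_neg[OF assms])
    qed
  qed
next
  assume "preserves_majorization \<phi>"
  then show "preserves_majorization_prob \<phi>"
    by (simp add: preserves_majorization_def preserves_majorization_prob_def)
qed

end
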